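(* Let $2\le p\le n$. The rank of the Rees quotient semigroup $RQ'_n(p)=M(n,p)/M(n,p-1)$ is $$\mathrm{rank}\,RQ'_n(p)=\binom{n}{p}+(n-2)\binom{n-3}{p-1}.$$
   Context: Let $[n]=\{1,2,\ldots,n\}$ with its usual order. $\mathcal{IC}_n$ is the monoid of all injective partial transformations $\alpha$ of $[n]$ (the empty map allowed) that are isotone ($x\le y$ implies $x\alpha\le y\alpha$ for all $x,y\in\mathrm{Dom}\,\alpha$) and order-decreasing ($x\alpha\le x$ for all $x\in \mathrm{Dom}\,\alpha$), maps being written on the right and composed left to right: $x(\alpha\beta)=(x\alpha)\beta$. $\mathcal{Q}'_n=\{\alpha\in\mathcal{IC}_n: 1\notin\mathrm{Dom}\,\alpha\}$ is a subsemigroup, and for $1\le p\le n$, $M(n,p)=\{\alpha\in\mathcal{Q}'_n:|\mathrm{Im}\,\alpha|\le p\}$ is a two-sided ideal of $\mathcal{Q}'_n$. The Rees quotient $RQ'_n(p)$, defined for $p\ge2$, can be viewed as the set of elements of $\mathcal{Q}'_n$ of height $|\mathrm{Im}\,\alpha|=p$ together with a zero $0$, where a product is $0$ whenever the product in $\mathcal{Q}'_n$ has height less than $p$. The rank of a finite semigroup $S$ is $\min\{|A|: A\subseteq S,\ \langle A\rangle=S\}$, where $\langle A\rangle$ is the subsemigroup generated by $A$. Binomial coefficients $\binom{a}{b}$ with $b>a$ are $0$. *)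

theory Defs
  imports Main
begin

section \<open>Subsemigroups, rank and Rees quotients\<close>

text \<open>A semigroup is given by a carrier set and a multiplication that is used only on the carrier.\<close>

inductive_set gen :: "('a \<Rightarrow> 'a \<Rightarrow> 'a) \<Rightarrow> 'a set \<Rightarrow> 'a set"
  for mul :: "'a \<Rightarrow> 'a \<Rightarrow> 'a" and A :: "'a set" where
  base: "a \<in> A \<Longrightarrow> a \<in> gen mul A"
| mult: "x \<in> gen mul A \<Longrightarrow> y \<in> gen mul A \<Longrightarrow> mul x y \<in> gen mul A"

definition semigroup_on :: "'a set \<Rightarrow> ('a \<Rightarrow> 'a \<Rightarrow> 'a) \<Rightarrow> bool" where
  "semigroup_on S mul \<longleftrightarrow>
     (\<forall>x\<in>S. \<forall>y\<in>S. mul x y \<in> S) \<and>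
     (\<forall>x\<in>S. \<forall>y\<in>S. \<forall>z\<in>S. mul (mul x y) z = mul x (mul y z))"

definition ideal_of :: "'a set \<Rightarrow> 'a set \<Rightarrow> ('a \<Rightarrow> 'a \<Rightarrow> 'a) \<Rightarrow> bool" where
  "ideal_of I S mul \<longleftrightarrow>
     I \<noteq> {} \<and> I \<subseteq> S \<and> (\<forall>x\<in>S. \<forall>y\<in>I. mul x y \<in> I \<and> mul y x \<in> I)"

text \<open>The minimum is over a nonempty set of cardinalities when the carrier is finite and closed
  under the multiplication, see \<open>srank_attained\<close>.\<close>

definition srank :: "'a set \<Rightarrow> ('a \<Rightarrow> 'a \<Rightarrow> 'a) \<Rightarrow> nat" where
  "srank S mul = (LEAST k. \<exists>A. A \<subseteq> S \<and> finite A \<and> card A = k \<and> gen mul A = S)"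

definition rees_rel :: "'a set \<Rightarrow> 'a set \<Rightarrow> ('a \<times> 'a) set" where
  "rees_rel S I = {(x, y). x \<in> S \<and> y \<in> S \<and> (x = y \<or> x \<in> I \<and> y \<in> I)}"

definition rees_carrier :: "'a set \<Rightarrow> 'a set \<Rightarrow> 'a set set" where
  "rees_carrier S I = S // rees_rel S I"

text \<open>The class of \<open>xy\<close>, for any representatives \<open>x\<close> of \<open>X\<close> and \<open>y\<close> of \<open>Y\<close>;
  see \<open>rees_mult_class\<close>.\<close>

definition rees_mult ::
  "'a set \<Rightarrow> 'a set \<Rightarrow> ('a \<Rightarrow> 'a \<Rightarrow> 'a) \<Rightarrow> 'a set \<Rightarrow> 'a set \<Rightarrow> 'a set" where
  "rees_mult S I mul X Y = (\<Union>x\<in>X. \<Union>y\<in>Y. rees_rel S I `` {mul x y})"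

lemma equiv_rees_rel: "equiv S (rees_rel S I)"
  by (auto simp: equiv_def refl_on_def sym_def trans_def rees_rel_def)

lemma rees_mult_class:
  assumes S: "semigroup_on S mul" and I: "ideal_of I S mul" and x: "x \<in> S" and y: "y \<in> S"
  shows "rees_mult S I mul (rees_rel S I `` {x}) (rees_rel S I `` {y}) = rees_rel S I `` {mul x y}"
proof -
  have "rees_rel S I `` {mul x' y'} = rees_rel S I `` {mul x y}"
    if "(x, x') \<in> rees_rel S I" "(y, y') \<in> rees_rel S I" for x' y'
  proof -
    have "(mul x' y', mul x y) \<in> rees_rel S I"
      using that S I unfolding rees_rel_def semigroup_on_def ideal_of_def by auto
    then show ?thesis
      by (rule equiv_class_eq[OF equiv_rees_rel])
  qed
  moreover have "(x, x) \<in> rees_rel S I" "(y, y) \<in> rees_rel S I"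
    using x y by (auto simp: rees_rel_def)
  ultimately show ?thesis
    unfolding rees_mult_def by blast
qed

lemma srank_attained:
  assumes "finite S" and "\<And>x y. x \<in> S \<Longrightarrow> y \<in> S \<Longrightarrow> mul x y \<in> S"
  shows "\<exists>A. A \<subseteq> S \<and> finite A \<and> card A = srank S mul \<and> gen mul A = S"
proof -
  have "x \<in> S" if "x \<in> gen mul S" for x
    using that by induction (auto intro: assms)
  then have "gen mul S = S"
    by (auto intro: gen.base)
  then have "\<exists>k. \<exists>A. A \<subseteq> S \<and> finite A \<and> card A = k \<and> gen mul A = S"
    using assms(1) by blast
  then show ?thesis
    unfolding srank_def by (rule LeastI_ex)
qed


section \<open>Order-decreasing isotone partial injections\<close>

type_synonym ptrans = "nat \<Rightarrow> nat option"

text \<open>Maps act on the right: in \<open>pmult \<alpha> \<beta>\<close>, first \<open>\<alpha>\<close> is applied, then \<open>\<beta>\<close>.\<close>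

definition pmult :: "ptrans \<Rightarrow> ptrans \<Rightarrow> ptrans" where
  "pmult \<alpha> \<beta> = \<beta> \<circ>\<^sub>m \<alpha>"

definition IC :: "nat \<Rightarrow> ptrans set" where
  "IC n = {\<alpha>. dom \<alpha> \<subseteq> {1..n} \<and> ran \<alpha> \<subseteq> {1..n} \<and>
              inj_on \<alpha> (dom \<alpha>) \<and>
              mono_on (dom \<alpha>) (\<lambda>x. the (\<alpha> x)) \<and>
              (\<forall>x\<in>dom \<alpha>. the (\<alpha> x) \<le> x)}"

definition Q' :: "nat \<Rightarrow> ptrans set" where
  "Q' n = {\<alpha> \<in> IC n. 1 \<notin> dom \<alpha>}"

definition height :: "ptrans \<Rightarrow> nat" where
  "height \<alpha> = card (ran \<alpha>)"

definition M :: "nat \<Rightarrow> nat \<Rightarrow> ptrans set" where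
  "M n p = {\<alpha> \<in> Q' n. height \<alpha> \<le> p}"

definition RQ' :: "nat \<Rightarrow> nat \<Rightarrow> ptrans set set" where
  "RQ' n p = rees_carrier (M n p) (M n (p - 1))"

definition RQ'_mult :: "nat \<Rightarrow> nat \<Rightarrow> ptrans set \<Rightarrow> ptrans set \<Rightarrow> ptrans set" where
  "RQ'_mult n p = rees_mult (M n p) (M n (p - 1)) pmult"

lemma IC_pmult:
  assumes a: "\<alpha> \<in> IC n" and b: "\<beta> \<in> IC n"
  shows "pmult \<alpha> \<beta> \<in> IC n"
proof -
  have dom_eq: "x \<in> dom (pmult \<alpha> \<beta>) \<longleftrightarrow> (\<exists>y z. \<alpha> x = Some y \<and> \<beta> y = Some z)" for x
    by (auto simp: pmult_def map_comp_def split: option.splits)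
  have val: "pmult \<alpha> \<beta> x = Some z" if "\<alpha> x = Some y" "\<beta> y = Some z" for x y z
    using that by (simp add: pmult_def)
  have inja: "x = x'" if "\<alpha> x = Some y" "\<alpha> x' = Some y" for x x' y
    using a that inj_onD[of \<alpha> "dom \<alpha>" x x'] unfolding IC_def by (simp add: domI)
  have injb: "x = x'" if "\<beta> x = Some y" "\<beta> x' = Some y" for x x' y
    using b that inj_onD[of \<beta> "dom \<beta>" x x'] unfolding IC_def by (simp add: domI)
  have monoa: "y \<le> y'" if "\<alpha> x = Some y" "\<alpha> x' = Some y'" "x \<le> x'" for x x' y y'
    using a that mono_onD[of "dom \<alpha>" "\<lambda>x. the (\<alpha> x)" x x'] unfolding IC_def by (simp add: domI)
  have monob: "y \<le> y'" if "\<beta> x = Some y" "\<beta> x' = Some y'" "x \<le> x'" for x x' y y'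
    using b that mono_onD[of "dom \<beta>" "\<lambda>x. the (\<beta> x)" x x'] unfolding IC_def by (simp add: domI)
  have deca: "y \<le> x" if "\<alpha> x = Some y" for x y
  proof -
    have "the (\<alpha> x) \<le> x"
      using a domI[of \<alpha> x y, OF that] unfolding IC_def by blast
    then show ?thesis
      using that by simp
  qed
  have decb: "y \<le> x" if "\<beta> x = Some y" for x y
  proof -
    have "the (\<beta> x) \<le> x"
      using b domI[of \<beta> x y, OF that] unfolding IC_def by blast
    then show ?thesis
      using that by simp
  qed
  have "dom (pmult \<alpha> \<beta>) \<subseteq> dom \<alpha>"
    using dom_eq by blast
  then have "dom (pmult \<alpha> \<beta>) \<subseteq> {1..n}"
    using a unfolding IC_def by blast
  moreover have "ran (pmult \<alpha> \<beta>) \<subseteq> {1..n}"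
  proof -
    have "ran (pmult \<alpha> \<beta>) \<subseteq> ran \<beta>"
      by (auto simp: pmult_def ran_def map_comp_def split: option.splits)
    then show ?thesis
      using b unfolding IC_def by blast
  qed
  moreover have "inj_on (pmult \<alpha> \<beta>) (dom (pmult \<alpha> \<beta>))"
  proof (rule inj_onI)
    fix x x' assume "x \<in> dom (pmult \<alpha> \<beta>)" "x' \<in> dom (pmult \<alpha> \<beta>)"
      and eq: "pmult \<alpha> \<beta> x = pmult \<alpha> \<beta> x'"
    then obtain y z y' z' where *: "\<alpha> x = Some y" "\<beta> y = Some z" "\<alpha> x' = Some y'" "\<beta> y' = Some z'"
      unfolding dom_eq by blast
    have "z = z'"
      using eq val[OF *(1,2)] val[OF *(3,4)] by simp
    then have "y = y'"
      using injb[of y z y'] *(2,4) by simp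
    then show "x = x'"
      using inja[of x y x'] *(1,3) by simp
  qed
  moreover have "mono_on (dom (pmult \<alpha> \<beta>)) (\<lambda>x. the (pmult \<alpha> \<beta> x))"
  proof (rule mono_onI)
    fix x x' assume "x \<in> dom (pmult \<alpha> \<beta>)" "x' \<in> dom (pmult \<alpha> \<beta>)" and le: "x \<le> x'"
    then obtain y z y' z' where *: "\<alpha> x = Some y" "\<beta> y = Some z" "\<alpha> x' = Some y'" "\<beta> y' = Some z'"
      unfolding dom_eq by blast
    have "z \<le> z'"
      by (rule monob[OF *(2,4) monoa[OF *(1,3) le]])
    then show "the (pmult \<alpha> \<beta> x) \<le> the (pmult \<alpha> \<beta> x')"
      by (simp add: val[OF *(1,2)] val[OF *(3,4)])
  qed
  moreover have "\<forall>x\<in>dom (pmult \<alpha> \<beta>). the (pmult \<alpha> \<beta> x) \<le> x"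
  proof
    fix x assume "x \<in> dom (pmult \<alpha> \<beta>)"
    then obtain y z where *: "\<alpha> x = Some y" "\<beta> y = Some z"
      unfolding dom_eq by blast
    show "the (pmult \<alpha> \<beta> x) \<le> x"
      using deca[OF *(1)] decb[OF *(2)] val[OF *] by simp
  qed
  ultimately show ?thesis
    unfolding IC_def by simp
qed

lemma Q'_pmult: "\<alpha> \<in> Q' n \<Longrightarrow> \<beta> \<in> Q' n \<Longrightarrow> pmult \<alpha> \<beta> \<in> Q' n"
  using IC_pmult by (auto simp: Q'_def pmult_def map_comp_def split: option.splits)

lemma finite_ran_Q': "\<alpha> \<in> Q' n \<Longrightarrow> finite (ran \<alpha>)"
  unfolding Q'_def IC_def by (auto intro: finite_subset)

lemma height_pmult:
  assumes "\<alpha> \<in> Q' n" "\<beta> \<in> Q' n"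
  shows "height (pmult \<alpha> \<beta>) \<le> height \<alpha>" and "height (pmult \<alpha> \<beta>) \<le> height \<beta>"
proof -
  have "ran (pmult \<alpha> \<beta>) \<subseteq> (\<lambda>y. the (\<beta> y)) ` ran \<alpha>"
    by (force simp: pmult_def ran_def map_comp_def split: option.splits)
  then show "height (pmult \<alpha> \<beta>) \<le> height \<alpha>"
    unfolding height_def using surj_card_le[OF finite_ran_Q'[OF assms(1)]] by blast
  have "ran (pmult \<alpha> \<beta>) \<subseteq> ran \<beta>"
    by (auto simp: pmult_def ran_def map_comp_def split: option.splits)
  then show "height (pmult \<alpha> \<beta>) \<le> height \<beta>"
    unfolding height_def by (rule card_mono[OF finite_ran_Q'[OF assms(2)]])
qed

lemma semigroup_on_M: "semigroup_on (M n p) pmult"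
proof -
  have "pmult \<alpha> \<beta> \<in> M n p" if "\<alpha> \<in> M n p" "\<beta> \<in> M n p" for \<alpha> \<beta>
    using that Q'_pmult height_pmult(1)[of \<alpha> n \<beta>] unfolding M_def by auto
  moreover have "pmult (pmult \<alpha> \<beta>) \<gamma> = pmult \<alpha> (pmult \<beta> \<gamma>)" for \<alpha> \<beta> \<gamma>
    by (auto simp: pmult_def map_comp_def fun_eq_iff split: option.splits)
  ultimately show ?thesis
    unfolding semigroup_on_def by blast
qed

lemma ideal_of_M: "q \<le> p \<Longrightarrow> ideal_of (M n q) (M n p) pmult"
proof -
  assume "q \<le> p"
  have "Map.empty \<in> M n q"
    by (simp add: M_def Q'_def IC_def height_def mono_on_def)
  moreover have "pmult \<alpha> \<beta> \<in> M n q \<and> pmult \<beta> \<alpha> \<in> M n q" if "\<alpha> \<in> M n p" "\<beta> \<in> M n q" for \<alpha> \<beta>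
    using that Q'_pmult height_pmult[of \<alpha> n \<beta>] height_pmult[of \<beta> n \<alpha>] unfolding M_def by auto
  ultimately show ?thesis
    using \<open>q \<le> p\<close> unfolding ideal_of_def by (auto simp: M_def)
qed

end

theory Submission
  imports Defs
begin

text \<open>Call \<open>x\<close> irreducible if \<open>x = yz\<close> forces \<open>x = y\<close> or \<open>x = z\<close>. Every generating set contains
  all irreducibles, so if these generate, their number is the rank. A map of height \<open>p\<close> is a
  pair of \<open>p\<close>-subsets \<open>A \<subseteq> {2..n}\<close> (domain) and \<open>C \<subseteq> {1..n}\<close> (image), listed increasingly, with
  \<open>C \<le> A\<close> entrywise, and its factorizations in the quotient are \<open>(A, C) = (A, B)(B, C)\<close> with
  \<open>C \<le> B \<le> A\<close> and \<open>B \<subseteq> {2..n}\<close>. So \<open>(A, C)\<close> is irreducible iff \<open>A\<close> is the least subset of \<open>{2..n}\<close>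
  above \<open>C\<close>, which happens once for each of the \<open>n choose p\<close> sets \<open>C\<close>, or \<open>C \<subseteq> {2..n}\<close> and \<open>A\<close>
  arises from \<open>C\<close> by replacing some \<open>a\<close> with \<open>a + 1\<close>: there are \<open>n - 2\<close> choices for \<open>a\<close>, and the
  other \<open>p - 1\<close> elements come from \<open>{2..n} - {a, a + 1}\<close>.\<close>

section \<open>Irreducible elements and the rank\<close>

definition irreducibles :: "'a set \<Rightarrow> ('a \<Rightarrow> 'a \<Rightarrow> 'a) \<Rightarrow> 'a set" where
  "irreducibles S mul = {x \<in> S. \<forall>y\<in>S. \<forall>z\<in>S. x = mul y z \<longrightarrow> x = y \<or> x = z}"

lemma gen_subset:
  assumes "\<And>x y. x \<in> S \<Longrightarrow> y \<in> S \<Longrightarrow> mul x y \<in> S" and "A \<subseteq> S"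
  shows "gen mul A \<subseteq> S"
proof
  fix x assume "x \<in> gen mul A"
  then show "x \<in> S"
    by induction (use assms in auto)
qed

text \<open>Induction on how \<open>x\<close> is generated: if a product is irreducible, one factor
  equals it, so that factor is irreducible too and lies in \<open>A\<close> by the induction
  hypothesis.\<close>

lemma irreducibles_subset_generators:
  assumes "gen mul A = S"
  shows "irreducibles S mul \<subseteq> A"
proof
  fix x assume x: "x \<in> irreducibles S mul"
  then have "x \<in> gen mul A"
    using assms by (simp add: irreducibles_def)
  then show "x \<in> A"
    using x
  proof induction
    case (mult x y)
    then have "mul x y = x \<or> mul x y = y"
      using assms unfolding irreducibles_def by blast
    then show ?case
      using mult by auto
  qed
qed

lemma srank_eq_card_irreducibles:
  assumes "finite S" and "gen mul (irreducibles S mul) = S"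
  shows "srank S mul = card (irreducibles S mul)"
  unfolding srank_def
proof (rule Least_equality)
  have "irreducibles S mul \<subseteq> S"
    by (auto simp: irreducibles_def)
  then show "\<exists>A\<subseteq>S. finite A \<and> card A = card (irreducibles S mul) \<and> gen mul A = S"
    using assms finite_subset by blast
next
  fix k assume "\<exists>A\<subseteq>S. finite A \<and> card A = k \<and> gen mul A = S"
  then show "card (irreducibles S mul) \<le> k"
    using irreducibles_subset_generators card_mono by metis
qed


section \<open>Strictly increasing lists\<close>

text \<open>Lists stand for \<open>p\<close>-subsets of \<open>{l..n}\<close>: entrywise comparison
  becomes \<open>list_all2 (\<le>)\<close>, replacing an element becomes a list update, and
  \<open>sum_list\<close> provides a measure for induction.\<close>

definition inc_lists :: "nat \<Rightarrow> nat \<Rightarrow> nat \<Rightarrow> nat list set" where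
  "inc_lists l n p = {xs. sorted_wrt (<) xs \<and> length xs = p \<and> set xs \<subseteq> {l..n}}"

lemma inc_lists_eqI:
  "xs \<in> inc_lists l n p \<Longrightarrow> ys \<in> inc_lists l' n' p' \<Longrightarrow> set xs = set ys \<Longrightarrow> xs = ys"
  by (auto simp: inc_lists_def intro: strict_sorted_equal)

lemma inc_lists_nth_less:
  "xs \<in> inc_lists l n p \<Longrightarrow> i < j \<Longrightarrow> j < p \<Longrightarrow> xs ! i < xs ! j"
  by (auto simp: inc_lists_def sorted_wrt_iff_nth_less)

lemma inc_lists_nth_bounds:
  assumes "xs \<in> inc_lists l n p" "i < p"
  shows "l \<le> xs ! i" "xs ! i \<le> n"
  using assms nth_mem[of i xs] unfolding inc_lists_def by (auto dest!: subsetD)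

lemma inc_lists_length: "xs \<in> inc_lists l n p \<Longrightarrow> length xs = p"
  by (simp add: inc_lists_def)

lemma inc_lists_distinct: "xs \<in> inc_lists l n p \<Longrightarrow> distinct xs"
  by (simp add: inc_lists_def strict_sorted_iff)

lemma inc_lists_mono: "l' \<le> l \<Longrightarrow> inc_lists l n p \<subseteq> inc_lists l' n p"
  by (auto simp: inc_lists_def)

lemma bij_betw_set_inc_lists:
  "bij_betw set (inc_lists l n p) {A. A \<subseteq> {l..n} \<and> card A = p}"
  unfolding bij_betw_def
proof
  show "inj_on set (inc_lists l n p)"
    by (auto intro: inj_onI inc_lists_eqI)
  show "set ` inc_lists l n p = {A. A \<subseteq> {l..n} \<and> card A = p}"
  proof
    show "set ` inc_lists l n p \<subseteq> {A. A \<subseteq> {l..n} \<and> card A = p}"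
      by (auto simp: inc_lists_def strict_sorted_iff distinct_card)
    show "{A. A \<subseteq> {l..n} \<and> card A = p} \<subseteq> set ` inc_lists l n p"
    proof
      fix A assume "A \<in> {A. A \<subseteq> {l..n} \<and> card A = p}"
      then have "finite A" "A \<subseteq> {l..n}" "card A = p"
        by (auto intro: finite_subset)
      then have "sorted_list_of_set A \<in> inc_lists l n p" "A = set (sorted_list_of_set A)"
        by (auto simp: inc_lists_def)
      then show "A \<in> set ` inc_lists l n p"
        by blast
    qed
  qed
qed

lemma finite_inc_lists: "finite (inc_lists l n p)"
  using bij_betw_finite[OF bij_betw_set_inc_lists] by (simp add: finite_subset[of _ "Pow {l..n}"])

lemma card_inc_lists: "card (inc_lists l n p) = (n + 1 - l) choose p"
  using bij_betw_same_card[OF bij_betw_set_inc_lists] by (simp add: n_subsets)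

lemma inc_lists_nth_ge:
  assumes "xs \<in> inc_lists l n p" "i < p"
  shows "i + l \<le> xs ! i"
  using assms(2)
proof (induction i)
  case 0
  then show ?case
    using inc_lists_nth_bounds[OF assms(1)] by simp
next
  case (Suc i)
  then show ?case
    using inc_lists_nth_less[OF assms(1), of i "Suc i"] by simp
qed

text \<open>Earlier entries stay below the raised one, and later entries exceed the next one, so
  only the gap to the next entry has to be assumed.\<close>

lemma inc_lists_update_Suc:
  assumes "cs \<in> inc_lists l n p" "i < p" "Suc (cs ! i) \<le> n"
    and gap: "Suc i < p \<Longrightarrow> Suc (cs ! i) < cs ! Suc i"
  shows "cs[i := Suc (cs ! i)] \<in> inc_lists l n p"
proof -
  have len: "length cs = p"
    using assms(1) by (rule inc_lists_length)
  have "cs[i := Suc (cs ! i)] ! j < cs[i := Suc (cs ! i)] ! k" if "j < k" "k < p" for j k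
  proof -
    have "Suc (cs ! i) < cs ! k" if "i < k" "k < p"
    proof (cases "k = Suc i")
      case False
      then have "cs ! Suc i < cs ! k"
        using inc_lists_nth_less[OF assms(1), of "Suc i" k] that by simp
      then show ?thesis
        using gap that by simp
    qed (use gap that in simp)
    moreover have "cs ! j < cs ! k"
      using inc_lists_nth_less[OF assms(1)] that by blast
    ultimately show ?thesis
      using that len \<open>i < p\<close> by (auto simp: nth_list_update)
  qed
  moreover have "set (cs[i := Suc (cs ! i)]) \<subseteq> {l..n}"
    using set_update_subset_insert[of cs i "Suc (cs ! i)"] assms(1,3)
      inc_lists_nth_bounds[OF assms(1,2)] by (fastforce simp: inc_lists_def)
  ultimately show ?thesis
    using len by (simp add: inc_lists_def sorted_wrt_iff_nth_less)
qed

section \<open>The entrywise order on lists\<close>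

lemma sum_list_strict_mono_list_all2:
  fixes xs ys :: "nat list"
  assumes "list_all2 (\<le>) xs ys" "xs \<noteq> ys"
  shows "sum_list xs < sum_list ys"
  using assms
proof (induction rule: list_all2_induct)
  case (Cons x xs y ys)
  show ?case
  proof (cases "xs = ys")
    case False
    then show ?thesis using Cons by simp
  qed (use Cons in simp)
qed simp

lemma list_all2_le_antisym: "list_all2 (\<le>) xs ys \<Longrightarrow> list_all2 (\<le>) ys (xs :: nat list) \<Longrightarrow> xs = ys"
  by (auto simp: list_all2_conv_all_nth intro!: nth_equalityI antisym)

lemma list_all2_le_trans:
  "list_all2 (\<le>) xs ys \<Longrightarrow> list_all2 (\<le>) ys zs \<Longrightarrow> list_all2 (\<le>) xs (zs :: nat list)"
  by (rule list_all2_trans) auto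

text \<open>The least increasing list with entries at least \<open>2\<close> above a given one: entry number \<open>i\<close>, counted
  from \<open>0\<close>, of such a list is at least \<open>i + 2\<close>.\<close>

definition lift_list :: "nat list \<Rightarrow> nat list" where
  "lift_list cs = map (\<lambda>i. max (cs ! i) (i + 2)) [0..<length cs]"

lemma lift_list_upper: "list_all2 (\<le>) cs (lift_list cs)"
  by (simp add: lift_list_def list_all2_conv_all_nth)

lemma lift_list_least:
  assumes "bs \<in> inc_lists 2 n p" "list_all2 (\<le>) cs bs"
  shows "list_all2 (\<le>) (lift_list cs) bs"
  using assms inc_lists_nth_ge[OF assms(1)]
  by (auto simp: lift_list_def list_all2_conv_all_nth inc_lists_length[OF assms(1)])

lemma lift_list_id: "cs \<in> inc_lists 2 n p \<Longrightarrow> lift_list cs = cs"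
  by (rule list_all2_le_antisym[OF lift_list_least lift_list_upper]) (auto simp: list_all2_refl)

text \<open>The bound \<open>p < n\<close> matters at the last index \<open>p - 1\<close>, where the
  floor \<open>i + 2\<close> is \<open>p + 1\<close> and must not exceed \<open>n\<close>.\<close>

lemma lift_list_in:
  assumes "cs \<in> inc_lists 1 n p" "p < n"
  shows "lift_list cs \<in> inc_lists 2 n p"
proof -
  have len: "length cs = p"
    using assms(1) by (rule inc_lists_length)
  have "max (cs ! i) (i + 2) < max (cs ! j) (j + 2)" if "i < j" "j < p" for i j
    using inc_lists_nth_less[OF assms(1) that] that by auto
  then show ?thesis
    using assms(2) inc_lists_nth_bounds[OF assms(1)]
    by (auto simp: inc_lists_def lift_list_def len sorted_wrt_iff_nth_less)
qed


section \<open>Irreducible pairs\<close>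

text \<open>The first list is the domain and the second the image of a map of height
  \<open>p\<close>. The lower bound \<open>2\<close> for the domain encodes that it avoids
  \<open>1\<close>, as required in \<open>Q' n\<close>.\<close>

definition dec_pairs :: "nat \<Rightarrow> nat \<Rightarrow> (nat list \<times> nat list) set" where
  "dec_pairs n p =
     {(as, cs). as \<in> inc_lists 2 n p \<and> cs \<in> inc_lists 1 n p \<and> list_all2 (\<le>) cs as}"

text \<open>Here \<open>bs\<close> is the image of a left factor and also the domain of a right
  factor, hence its lower bound \<open>2\<close>. The alternative \<open>bs = cs\<close> can
  therefore occur only if \<open>cs\<close> avoids \<open>1\<close>.\<close>

definition irr_pairs :: "nat \<Rightarrow> nat \<Rightarrow> (nat list \<times> nat list) set" where
  "irr_pairs n p = {(as, cs). (as, cs) \<in> dec_pairs n p \<and>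
     (\<forall>bs\<in>inc_lists 2 n p. list_all2 (\<le>) cs bs \<and> list_all2 (\<le>) bs as \<longrightarrow> bs = as \<or> bs = cs)}"

text \<open>These are the covers of the entrywise order on \<open>inc_lists 2 n p\<close>: no list
  lies strictly between the two, and by \<open>exists_cover_below\<close> every strict comparison
  starts with such a pair.\<close>

definition cover_pairs :: "nat \<Rightarrow> nat \<Rightarrow> (nat list \<times> nat list) set" where
  "cover_pairs n p = {(as, cs). as \<in> inc_lists 2 n p \<and> cs \<in> inc_lists 2 n p \<and>
     (\<exists>i<p. as = cs[i := Suc (cs ! i)])}"

text \<open>Raising the last entry in which the two lists differ keeps the list increasing.\<close>

lemma exists_cover_below:
  assumes as: "as \<in> inc_lists l n p" and cs: "cs \<in> inc_lists l n p"
    and le: "list_all2 (\<le>) cs as" and ne: "as \<noteq> cs"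
  obtains i where "i < p" "cs[i := Suc (cs ! i)] \<in> inc_lists l n p"
    "list_all2 (\<le>) (cs[i := Suc (cs ! i)]) as"
proof -
  define D where "D = {i. i < p \<and> cs ! i \<noteq> as ! i}"
  define i where "i = Max D"
  have len: "length as = p" "length cs = p"
    using as cs by (simp_all add: inc_lists_length)
  have "finite D" "D \<noteq> {}"
    using ne len by (auto simp: D_def intro: nth_equalityI)
  then have "i \<in> D" and max: "\<And>j. j \<in> D \<Longrightarrow> j \<le> i"
    unfolding i_def by simp_all
  then have i: "i < p" "cs ! i \<noteq> as ! i"
    by (auto simp: D_def)
  then have less: "cs ! i < as ! i"
    using le len by (simp add: list_all2_conv_all_nth le_neq_implies_less)
  have "cs[i := Suc (cs ! i)] \<in> inc_lists l n p"
  proof (rule inc_lists_update_Suc[OF cs i(1)])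
    show "Suc (cs ! i) \<le> n"
      using less inc_lists_nth_bounds(2)[OF as i(1)] by simp
    assume "Suc i < p"
    then have "cs ! Suc i = as ! Suc i"
      using max[of "Suc i"] by (auto simp: D_def)
    then show "Suc (cs ! i) < cs ! Suc i"
      using less inc_lists_nth_less[OF as, of i "Suc i"] \<open>Suc i < p\<close> by simp
  qed
  moreover have "list_all2 (\<le>) (cs[i := Suc (cs ! i)]) as"
    using le less len i(1) by (auto simp: list_all2_conv_all_nth nth_list_update)
  ultimately show ?thesis
    using i(1) that by blast
qed

text \<open>The list \<open>lift_list cs\<close> lies between \<open>cs\<close> and
  \<open>as\<close>, so in an irreducible pair it equals one of them. If it equals \<open>cs\<close>
  and \<open>as\<close> differs from \<open>cs\<close>, then a cover of \<open>cs\<close> below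
  \<open>as\<close> exists in \<open>inc_lists 2 n p\<close> and must be \<open>as\<close>.
  Conversely, leastness of the lift leaves nothing else between it and \<open>cs\<close>, and a
  cover leaves nothing strictly between.\<close>

lemma irr_pairs_eq:
  assumes "p < n"
  shows "irr_pairs n p = (\<lambda>cs. (lift_list cs, cs)) ` inc_lists 1 n p \<union> cover_pairs n p"
proof (intro equalityI subsetI)
  fix x assume "x \<in> irr_pairs n p"
  then obtain as cs where x: "x = (as, cs)" and as: "as \<in> inc_lists 2 n p"
    and cs: "cs \<in> inc_lists 1 n p" and le: "list_all2 (\<le>) cs as"
    and irr: "\<And>bs. bs \<in> inc_lists 2 n p \<Longrightarrow> list_all2 (\<le>) cs bs \<Longrightarrow> list_all2 (\<le>) bs as \<Longrightarrow>
      bs = as \<or> bs = cs"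
    by (auto simp: irr_pairs_def dec_pairs_def)
  have "lift_list cs = as \<or> lift_list cs = cs"
    using irr[OF lift_list_in[OF cs assms] lift_list_upper lift_list_least[OF as le]] .
  moreover have "x \<in> cover_pairs n p" if "as \<noteq> cs" "lift_list cs = cs"
  proof -
    have cs2: "cs \<in> inc_lists 2 n p"
      using lift_list_in[OF cs assms] that by simp
    obtain i where i: "i < p" "cs[i := Suc (cs ! i)] \<in> inc_lists 2 n p"
      "list_all2 (\<le>) (cs[i := Suc (cs ! i)]) as"
      using exists_cover_below[OF as cs2 le \<open>as \<noteq> cs\<close>] .
    have "list_all2 (\<le>) cs (cs[i := Suc (cs ! i)])"
      using i(1) inc_lists_length[OF cs] by (auto simp: list_all2_conv_all_nth nth_list_update)
    then have "cs[i := Suc (cs ! i)] = as \<or> cs[i := Suc (cs ! i)] = cs"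
      using irr[OF i(2) _ i(3)] by blast
    moreover have "cs[i := Suc (cs ! i)] ! i \<noteq> cs ! i"
      using i(1) inc_lists_length[OF cs] by simp
    ultimately have "as = cs[i := Suc (cs ! i)]"
      by metis
    then show ?thesis
      using x as cs2 i(1) by (auto simp: cover_pairs_def)
  qed
  ultimately show "x \<in> (\<lambda>cs. (lift_list cs, cs)) ` inc_lists 1 n p \<union> cover_pairs n p"
    using x cs by (cases "lift_list cs = as") auto
next
  fix x assume "x \<in> (\<lambda>cs. (lift_list cs, cs)) ` inc_lists 1 n p \<union> cover_pairs n p"
  then show "x \<in> irr_pairs n p"
  proof
    assume "x \<in> (\<lambda>cs. (lift_list cs, cs)) ` inc_lists 1 n p"
    then obtain cs where x: "x = (lift_list cs, cs)" and cs: "cs \<in> inc_lists 1 n p"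
      by blast
    then show ?thesis
      using lift_list_in[OF cs assms] lift_list_upper[of cs]
      by (auto simp: irr_pairs_def dec_pairs_def dest: lift_list_least list_all2_le_antisym)
  next
    assume "x \<in> cover_pairs n p"
    then obtain as cs i where x: "x = (as, cs)" and as: "as \<in> inc_lists 2 n p"
      and cs: "cs \<in> inc_lists 2 n p" and i: "i < p" and eq: "as = cs[i := Suc (cs ! i)]"
      by (auto simp: cover_pairs_def)
    have len: "length cs = p"
      using cs by (rule inc_lists_length)
    \<comment> \<open>Away from \<open>i\<close> the lists \<open>as\<close> and \<open>cs\<close>
      agree and fix \<open>bs\<close>; at \<open>i\<close> they differ by one, which leaves two
      values.\<close>
    have "bs = as \<or> bs = cs" if "list_all2 (\<le>) cs bs" "list_all2 (\<le>) bs as" for bs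
    proof -
      have b: "cs ! j \<le> bs ! j" "bs ! j \<le> as ! j" if "j < p" for j
        using \<open>list_all2 (\<le>) cs bs\<close> \<open>list_all2 (\<le>) bs as\<close> that len
        by (auto simp: list_all2_conv_all_nth)
      have lb: "length bs = p"
        using \<open>list_all2 (\<le>) cs bs\<close> len by (simp add: list_all2_conv_all_nth)
      have off: "bs ! j = cs ! j" if "j < p" "j \<noteq> i" for j
        using b[OF that(1)] that eq by simp
      have "bs ! i = cs ! i \<or> bs ! i = Suc (cs ! i)"
        using b[OF i] eq i len by auto
      then show ?thesis
      proof
        assume "bs ! i = cs ! i"
        then have "bs = cs"
          using off lb len by (metis nth_equalityI)
        then show ?thesis ..
      next
        assume "bs ! i = Suc (cs ! i)"
        then have "bs = as"
          using off lb len eq i by (auto simp: nth_list_update intro!: nth_equalityI)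
        then show ?thesis ..
      qed
    qed
    moreover have "list_all2 (\<le>) cs as"
      using len i by (auto simp: eq list_all2_conv_all_nth nth_list_update)
    ultimately show ?thesis
      using x as cs inc_lists_mono[of 1 2 n p] by (auto simp: irr_pairs_def dec_pairs_def)
  qed
qed

section \<open>Counting covers\<close>

text \<open>A cover is encoded by the raised element \<open>a\<close> and the set \<open>D\<close>
  of the untouched entries. That \<open>Suc a\<close> is not in \<open>D\<close> is what yields the
  gap demanded by \<open>inc_lists_update_Suc\<close>.\<close>

lemma bij_betw_cover_pairs:
  assumes "1 \<le> p"
  shows "bij_betw (\<lambda>(as, cs). (set as, set cs)) (cover_pairs n p)
    ((\<lambda>(a, D). (insert (Suc a) D, insert a D)) `
      (SIGMA a:{2..<n}. {D. D \<subseteq> {2..n} - {a, Suc a} \<and> card D = p - 1}))" (is "bij_betw ?f _ ?R")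
  unfolding bij_betw_def
proof
  show "inj_on ?f (cover_pairs n p)"
    by (rule inj_onI) (auto simp: cover_pairs_def intro: inc_lists_eqI)
  show "?f ` cover_pairs n p = ?R"
  proof (intro equalityI subsetI)
    fix x assume "x \<in> ?f ` cover_pairs n p"
    then obtain as cs i where x: "x = (set as, set cs)" and as: "as \<in> inc_lists 2 n p"
      and cs: "cs \<in> inc_lists 2 n p" and i: "i < p" and eq: "as = cs[i := Suc (cs ! i)]"
      by (auto simp: cover_pairs_def)
    define a where "a = cs ! i"
    define D where "D = set cs - {a}"
    have len: "length cs = p"
      using cs by (rule inc_lists_length)
    have setas: "set as = insert (Suc a) D"
      using set_update_distinct[OF inc_lists_distinct[OF cs]] i len eq by (simp add: a_def D_def)
    have setcs: "set cs = insert a D"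
      using i len by (auto simp: a_def D_def)
    have card: "card (set cs) = p" "card (set as) = p"
      using distinct_card[OF inc_lists_distinct] inc_lists_length as cs by metis+
    have aD: "a \<notin> D" and finD: "finite D"
      by (simp_all add: D_def)
    then have cD: "card D = p - 1"
      using card(1) setcs by simp
    \<comment> \<open>Otherwise \<open>set as\<close> would be \<open>D\<close>, which has only
      \<open>p - 1\<close> elements.\<close>
    have "Suc a \<notin> D"
    proof
      assume "Suc a \<in> D"
      then have "card (set as) = p - 1"
        using setas cD by (simp add: insert_absorb)
      then show False
        using card(2) assms by simp
    qed
    moreover have "set as \<subseteq> {2..n}" "set cs \<subseteq> {2..n}"
      using as cs by (simp_all add: inc_lists_def)
    ultimately have "a \<in> {2..<n}" "D \<subseteq> {2..n} - {a, Suc a}"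
      using setas setcs aD by auto
    then show "x \<in> ?R"
      using x setas setcs cD by force
  next
    fix x assume "x \<in> ?R"
    then obtain a D where x: "x = (insert (Suc a) D, insert a D)" and a: "2 \<le> a" "a < n"
      and D: "D \<subseteq> {2..n}" "a \<notin> D" "Suc a \<notin> D" and cD: "card D = p - 1"
      by (fastforce simp del: One_nat_def)
    have "finite D"
      using D(1) finite_subset by blast
    then have "insert a D \<in> {A. A \<subseteq> {2..n} \<and> card A = p}"
      using a D cD assms by auto
    then have "insert a D \<in> set ` inc_lists 2 n p"
      unfolding bij_betw_imp_surj_on[OF bij_betw_set_inc_lists] .
    then obtain cs where cs: "cs \<in> inc_lists 2 n p" and setcs: "set cs = insert a D"
      by auto
    have len: "length cs = p"
      using cs by (rule inc_lists_length)
    obtain i where i: "i < p" "cs ! i = a"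
      using setcs len by (metis in_set_conv_nth insertI1)
    have "cs[i := Suc (cs ! i)] \<in> inc_lists 2 n p"
    proof (rule inc_lists_update_Suc[OF cs i(1)])
      show "Suc (cs ! i) \<le> n"
        using a i by simp
      assume "Suc i < p"
      then have "cs ! i < cs ! Suc i"
        by (intro inc_lists_nth_less[OF cs]) simp_all
      moreover have "cs ! Suc i \<noteq> Suc a"
        using nth_mem[of "Suc i" cs] \<open>Suc i < p\<close> D(3) unfolding setcs len by auto
      ultimately show "Suc (cs ! i) < cs ! Suc i"
        unfolding i(2) by linarith
    qed
    moreover have "set (cs[i := Suc (cs ! i)]) = insert (Suc a) D"
      using set_update_distinct[OF inc_lists_distinct[OF cs]] i len setcs D by simp
    ultimately have "(cs[i := Suc (cs ! i)], cs) \<in> cover_pairs n p"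
      "x = ?f (cs[i := Suc (cs ! i)], cs)"
      using x setcs cs i(1) unfolding cover_pairs_def by (blast, simp only: prod.case)
    then show "x \<in> ?f ` cover_pairs n p"
      by (rule rev_image_eqI)
  qed
qed

lemma card_cover_pairs:
  assumes "1 \<le> p"
  shows "card (cover_pairs n p) = (n - 2) * ((n - 3) choose (p - 1))"
proof -
  let ?S = "SIGMA a:{2..<n}. {D. D \<subseteq> {2..n} - {a, Suc a} \<and> card D = p - 1}"
  have "inj_on (\<lambda>(a, D). (insert (Suc a) D, insert a D)) ?S"
  proof (rule inj_onI, clarify)
    fix a D b E
    assume *: "D \<subseteq> {2..n} - {a, Suc a}" "E \<subseteq> {2..n} - {b, Suc b}"
      and 1: "insert (Suc a) D = insert (Suc b) E" and 2: "insert a D = insert b E"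
    \<comment> \<open>The raised element is recovered as the only element of the second set missing
      from the first.\<close>
    have "{a} = insert a D - insert (Suc a) D" "{b} = insert b E - insert (Suc b) E"
      using * by auto
    then have "a = b"
      using 1 2 by auto
    then show "a = b \<and> D = E"
      using 2 * by auto
  qed
  then have "card (cover_pairs n p) = card ?S"
    using bij_betw_same_card[OF bij_betw_cover_pairs[OF assms]] by (simp add: card_image)
  also have "\<dots> = (\<Sum>a\<in>{2..<n}. card {D. D \<subseteq> {2..n} - {a, Suc a} \<and> card D = p - 1})"
    by (subst card_SigmaI) (auto intro: finite_subset[of _ "Pow {2..n}"])
  also have "\<dots> = (\<Sum>a\<in>{2..<n}. (n - 3) choose (p - 1))"
  proof (rule sum.cong)
    fix a assume "a \<in> {2..<n}"
    \<comment> \<open>Both \<open>a\<close> and \<open>Suc a\<close> lie in \<open>{2..n}\<close>,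
      which has \<open>n - 1\<close> elements.\<close>
    then have "card ({2..n} - {a, Suc a}) = n - 3"
      by (subst card_Diff_subset) auto
    then show "card {D. D \<subseteq> {2..n} - {a, Suc a} \<and> card D = p - 1} = (n - 3) choose (p - 1)"
      by (subst n_subsets) auto
  qed simp
  finally show ?thesis
    by simp
qed

lemma card_irr_pairs:
  assumes "1 \<le> p" "p < n"
  shows "card (irr_pairs n p) = (n choose p) + (n - 2) * ((n - 3) choose (p - 1))"
proof -
  \<comment> \<open>In a cover \<open>cs\<close> avoids \<open>1\<close> and is its own lift,
    whereas \<open>as\<close> differs from it at the raised position. So the two families of
    irreducible pairs are disjoint and their sizes add.\<close>
  have "as \<noteq> lift_list cs" if "(as, cs) \<in> cover_pairs n p" for as cs
  proof -
    have "cs \<in> inc_lists 2 n p" "\<exists>i<p. as = cs[i := Suc (cs ! i)]"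
      using that by (simp_all add: cover_pairs_def)
    then obtain i where i: "i < p" "as = cs[i := Suc (cs ! i)]" and cs: "cs \<in> inc_lists 2 n p"
      by blast
    then have "as ! i \<noteq> cs ! i"
      using inc_lists_length[OF cs] by simp
    then show ?thesis
      using lift_list_id[OF cs] by auto
  qed
  then have "(\<lambda>cs. (lift_list cs, cs)) ` inc_lists 1 n p \<inter> cover_pairs n p = {}"
    by auto
  moreover have "finite (cover_pairs n p)"
    by (rule finite_subset[of _ "inc_lists 2 n p \<times> inc_lists 2 n p"])
      (auto simp: cover_pairs_def finite_inc_lists)
  moreover have "card ((\<lambda>cs. (lift_list cs, cs)) ` inc_lists 1 n p) = n choose p"
    by (subst card_image) (auto simp: inj_on_def card_inc_lists)
  ultimately show ?thesis
    by (simp add: irr_pairs_eq[OF assms(2)] card_Un_disjoint finite_inc_lists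
        card_cover_pairs[OF assms(1)])
qed

section \<open>Maps as pairs of lists\<close>

definition list_map :: "nat list \<Rightarrow> nat list \<Rightarrow> ptrans" where
  "list_map as cs = map_of (zip as cs)"

lemma list_map_eq_Some_iff:
  assumes "distinct as" "length as = length cs"
  shows "list_map as cs x = Some y \<longleftrightarrow> (\<exists>i<length as. x = as ! i \<and> y = cs ! i)"
  using assms by (auto simp: list_map_def set_zip)

lemma pmult_list_map:
  assumes "distinct as" "distinct bs" "length as = length bs" "length bs = length cs"
  shows "pmult (list_map as bs) (list_map bs cs) = list_map as cs"
proof
  fix x
  have "pmult (list_map as bs) (list_map bs cs) x = Some z \<longleftrightarrow> list_map as cs x = Some z" for z
    using assms by (auto simp: pmult_def map_comp_Some_iff list_map_eq_Some_iff nth_eq_iff_index_eq)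
  then show "pmult (list_map as bs) (list_map bs cs) x = list_map as cs x"
    by (metis not_Some_eq)
qed

lemma dec_pairsD:
  assumes "(as, cs) \<in> dec_pairs n p"
  shows "as \<in> inc_lists 2 n p" "cs \<in> inc_lists 1 n p" "list_all2 (\<le>) cs as"
    "length as = p" "length cs = p" "distinct as" "distinct cs"
  using assms by (auto simp: dec_pairs_def inc_lists_length inc_lists_distinct)

lemma dom_ran_list_map:
  assumes "(as, cs) \<in> dec_pairs n p"
  shows "dom (list_map as cs) = set as" "ran (list_map as cs) = set cs"
  using dec_pairsD[OF assms] by (simp_all add: list_map_def dom_map_of_zip ran_map_of_zip)

text \<open>The domain and the image can be read off the map, and an increasing list is determined
  by its set of entries.\<close>

lemma list_map_inject:
  assumes "(as, cs) \<in> dec_pairs n p" "(as', cs') \<in> dec_pairs n p"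
  shows "list_map as cs = list_map as' cs' \<longleftrightarrow> as = as' \<and> cs = cs'"
proof
  assume "list_map as cs = list_map as' cs'"
  then have "set as = set as'" "set cs = set cs'"
    using dom_ran_list_map[OF assms(1)] dom_ran_list_map[OF assms(2)] by simp_all
  then show "as = as' \<and> cs = cs'"
    using dec_pairsD[OF assms(1)] dec_pairsD[OF assms(2)] inc_lists_eqI by blast
qed simp

lemma list_map_in_Q':
  assumes "(as, cs) \<in> dec_pairs n p"
  shows "list_map as cs \<in> Q' n" "height (list_map as cs) = p"
proof -
  note * = dec_pairsD[OF assms] dom_ran_list_map[OF assms]
  have val: "list_map as cs (as ! i) = Some (cs ! i)" if "i < p" for i
    using * that by (auto simp: list_map_eq_Some_iff)
  have "inj_on (list_map as cs) (set as)"
    using * val by (auto simp: inj_on_def in_set_conv_nth nth_eq_iff_index_eq)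
  moreover have "mono_on (set as) (\<lambda>x. the (list_map as cs x))"
  proof (rule mono_onI)
    fix x y assume "x \<in> set as" "y \<in> set as" "x \<le> y"
    then obtain i j where ij: "i < p" "x = as ! i" "j < p" "y = as ! j"
      using * by (metis in_set_conv_nth)
    then have "i \<le> j"
      using \<open>x \<le> y\<close> inc_lists_nth_less[OF *(1), of j i] by (metis linorder_not_le)
    then have "cs ! i \<le> cs ! j"
      using inc_lists_nth_less[OF *(2), of i j] ij by (cases "i = j") auto
    then show "the (list_map as cs x) \<le> the (list_map as cs y)"
      using val ij by simp
  qed
  moreover have "\<forall>x\<in>set as. the (list_map as cs x) \<le> x"
    using * val by (auto simp: in_set_conv_nth list_all2_conv_all_nth)
  moreover have "set as \<subseteq> {2..n}" "set cs \<subseteq> {1..n}"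
    using * by (simp_all add: inc_lists_def)
  ultimately show "list_map as cs \<in> Q' n"
    using * by (auto simp: Q'_def IC_def)
  show "height (list_map as cs) = p"
    using * by (simp add: height_def distinct_card)
qed

lemma Q'_list_mapE:
  assumes \<alpha>: "\<alpha> \<in> Q' n"
  obtains as cs where "(as, cs) \<in> dec_pairs n (height \<alpha>)" "\<alpha> = list_map as cs"
proof -
  define f where "f x = the (\<alpha> x)" for x
  define as where "as = sorted_list_of_set (dom \<alpha>)"
  have dom: "dom \<alpha> \<subseteq> {1..n}" "1 \<notin> dom \<alpha>" and ran: "ran \<alpha> \<subseteq> {1..n}"
    and inj: "inj_on \<alpha> (dom \<alpha>)" and mono: "mono_on (dom \<alpha>) f" and dec: "\<forall>x\<in>dom \<alpha>. f x \<le> x"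
    using \<alpha> unfolding Q'_def IC_def f_def by blast+
  have val: "\<alpha> x = Some (f x)" if "x \<in> dom \<alpha>" for x
    using that by (auto simp: f_def)
  have fin: "finite (dom \<alpha>)"
    using dom(1) by (rule finite_subset) simp
  have injf: "inj_on f (dom \<alpha>)"
    using inj val by (auto simp: inj_on_def)
  have ranf: "ran \<alpha> = f ` dom \<alpha>"
    using val by (force simp: ran_def)
  have height: "height \<alpha> = card (dom \<alpha>)"
    by (simp add: height_def ranf card_image[OF injf])
  have set_as: "set as = dom \<alpha>" and len: "length as = height \<alpha>" and sorted: "sorted_wrt (<) as"
    using fin by (simp_all add: as_def height)
  \<comment> \<open>Isotone and injective together give strictly increasing, so the values along the
    sorted domain form an increasing list again.\<close>
  have "sorted_wrt (\<lambda>x y. f x < f y) as"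
  proof (rule sorted_wrt_mono_rel[OF _ sorted])
    fix x y assume xy: "x \<in> set as" "y \<in> set as" "x < y"
    then have "f x \<le> f y" "f x \<noteq> f y"
      using mono_onD[OF mono, of x y] inj_onD[OF injf, of x y] by (auto simp only: set_as)
    then show "f x < f y"
      by simp
  qed
  moreover have "dom \<alpha> \<subseteq> {2..n}"
  proof
    fix x assume "x \<in> dom \<alpha>"
    then have "x \<in> {1..n}" "x \<noteq> 1"
      using dom by blast+
    then show "x \<in> {2..n}"
      unfolding atLeastAtMost_iff by linarith
  qed
  moreover have "f (as ! i) \<le> as ! i" if "i < length as" for i
    using dec nth_mem[OF that] set_as by blast
  ultimately have "(as, map f as) \<in> dec_pairs n (height \<alpha>)"
    using ran sorted len
    by (simp add: dec_pairs_def inc_lists_def set_as sorted_wrt_map ranf list_all2_conv_all_nth)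
  moreover have "\<alpha> = list_map as (map f as)"
    using val by (auto simp: list_map_def map_of_zip_map set_as fun_eq_iff)
  ultimately show ?thesis
    using that by blast
qed

text \<open>Only points of \<open>set bs \<inter> set bs'\<close> survive the composition, and two
  distinct \<open>p\<close>-sets share fewer than \<open>p\<close> points.\<close>

lemma height_pmult_less:
  assumes "(as, bs) \<in> dec_pairs n p" "(bs', cs) \<in> dec_pairs n p" "bs \<noteq> bs'"
  shows "height (pmult (list_map as bs) (list_map bs' cs)) < p"
proof -
  let ?B = "set bs \<inter> set bs'"
  have "ran (pmult (list_map as bs) (list_map bs' cs)) \<subseteq> (\<lambda>y. the (list_map bs' cs y)) ` ?B"
  proof
    fix z assume "z \<in> ran (pmult (list_map as bs) (list_map bs' cs))"
    then obtain x y where "list_map as bs x = Some y" "list_map bs' cs y = Some z"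
      by (auto simp: ran_def pmult_def map_comp_Some_iff)
    then show "z \<in> (\<lambda>y. the (list_map bs' cs y)) ` ?B"
      using dom_ran_list_map[OF assms(1)] dom_ran_list_map[OF assms(2)]
      by (force intro: ranI domI image_eqI[of _ _ y])
  qed
  then have "height (pmult (list_map as bs) (list_map bs' cs)) \<le> card ?B"
    unfolding height_def by (rule surj_card_le[rotated]) simp
  also have "\<dots> < p"
  proof (rule ccontr)
    assume "\<not> card ?B < p"
    moreover have "card (set bs) = p" "card (set bs') = p"
      using dec_pairsD[OF assms(1)] dec_pairsD[OF assms(2)] by (simp_all add: distinct_card)
    ultimately have "?B = set bs" "?B = set bs'"
      by (metis card_seteq List.finite_set Int_lower1 not_less,
        metis card_seteq List.finite_set Int_lower2 not_less)
    then have "bs = bs'"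
      using dec_pairsD[OF assms(1)] dec_pairsD[OF assms(2)] inc_lists_eqI by blast
    then show False
      using assms(3) by simp
  qed
  finally show ?thesis .
qed


section \<open>The Rees quotient\<close>

lemma rees_class_in_ideal:
  "x \<in> I \<Longrightarrow> I \<subseteq> S \<Longrightarrow> rees_rel S I `` {x} = I"
  by (auto simp: rees_rel_def)

lemma rees_class_not_in_ideal:
  "x \<in> S \<Longrightarrow> x \<notin> I \<Longrightarrow> rees_rel S I `` {x} = {x}"
  by (auto simp: rees_rel_def)

lemma M_subset: "M n (p - 1) \<subseteq> M n p"
  by (auto simp: M_def)

lemma finite_M: "finite (M n p)"
proof (rule finite_subset)
  show "M n p \<subseteq> (\<Union>A\<in>Pow {1..n}. {\<alpha>. dom \<alpha> = A \<and> ran \<alpha> \<subseteq> {1..n}})"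
    by (auto simp: M_def Q'_def IC_def)
  show "finite (\<Union>A\<in>Pow {1..n}. {\<alpha> :: ptrans. dom \<alpha> = A \<and> ran \<alpha> \<subseteq> {1..n}})"
    by (intro finite_UN_I finite_set_of_finite_maps) (auto intro: finite_subset)
qed

lemma RQ'_mult_class:
  assumes "\<alpha> \<in> M n p" "\<beta> \<in> M n p"
  shows "RQ'_mult n p (rees_rel (M n p) (M n (p - 1)) `` {\<alpha>}) (rees_rel (M n p) (M n (p - 1)) `` {\<beta>})
    = rees_rel (M n p) (M n (p - 1)) `` {pmult \<alpha> \<beta>}"
  unfolding RQ'_mult_def using assms
  by (intro rees_mult_class semigroup_on_M ideal_of_M) auto

lemma RQ'_iff: "X \<in> RQ' n p \<longleftrightarrow> (\<exists>\<alpha>\<in>M n p. X = rees_rel (M n p) (M n (p - 1)) `` {\<alpha>})"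
  by (simp add: RQ'_def rees_carrier_def quotient_def)

lemma RQ'_mult_closed:
  assumes "X \<in> RQ' n p" "Y \<in> RQ' n p"
  shows "RQ'_mult n p X Y \<in> RQ' n p"
proof -
  obtain \<alpha> \<beta> where "\<alpha> \<in> M n p" "\<beta> \<in> M n p"
    "X = rees_rel (M n p) (M n (p - 1)) `` {\<alpha>}" "Y = rees_rel (M n p) (M n (p - 1)) `` {\<beta>}"
    using assms unfolding RQ'_iff by blast
  moreover from this have "pmult \<alpha> \<beta> \<in> M n p"
    using semigroup_on_M[of n p] unfolding semigroup_on_def by blast
  ultimately show ?thesis
    using RQ'_mult_class RQ'_iff by metis
qed

lemma finite_RQ': "finite (RQ' n p)"
  unfolding RQ'_def rees_carrier_def by (simp add: quotient_def finite_M)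

context
  fixes n p :: nat
  assumes p: "1 \<le> p"
begin

text \<open>Here \<open>1 \<le> p\<close> ensures that \<open>p - 1\<close>, a truncated
  subtraction, is really below \<open>p\<close>, so maps of height \<open>p\<close> lie outside the
  ideal and form singleton classes.\<close>

lemma list_map_class:
  assumes "(as, cs) \<in> dec_pairs n p"
  shows "list_map as cs \<in> M n p" "list_map as cs \<notin> M n (p - 1)"
    "rees_rel (M n p) (M n (p - 1)) `` {list_map as cs} = {list_map as cs}"
proof -
  show *: "list_map as cs \<in> M n p" "list_map as cs \<notin> M n (p - 1)"
    using list_map_in_Q'[OF assms] p by (auto simp: M_def)
  show "rees_rel (M n p) (M n (p - 1)) `` {list_map as cs} = {list_map as cs}"
    using * by (rule rees_class_not_in_ideal)
qed

lemma zero_class: "\<alpha> \<in> M n (p - 1) \<Longrightarrow> rees_rel (M n p) (M n (p - 1)) `` {\<alpha>} = M n (p - 1)"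
  using M_subset by (rule rees_class_in_ideal[rotated])

lemma empty_in_M: "Map.empty \<in> M n q"
  by (simp add: M_def Q'_def IC_def height_def mono_on_def)

text \<open>The ideal collapses to one class, the zero, while a map of \<open>M n p\<close> outside
  it has height exactly \<open>p\<close> and is alone in its class.\<close>

lemma RQ'_eq:
  "RQ' n p = insert (M n (p - 1)) ((\<lambda>(as, cs). {list_map as cs}) ` dec_pairs n p)"
proof (intro equalityI subsetI)
  fix X assume "X \<in> RQ' n p"
  then obtain \<alpha> where \<alpha>: "\<alpha> \<in> M n p" and X: "X = rees_rel (M n p) (M n (p - 1)) `` {\<alpha>}"
    unfolding RQ'_iff by blast
  show "X \<in> insert (M n (p - 1)) ((\<lambda>(as, cs). {list_map as cs}) ` dec_pairs n p)"
  proof (cases "\<alpha> \<in> M n (p - 1)")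
    case False
    then have "\<alpha> \<in> Q' n" "height \<alpha> = p"
      using \<alpha> by (auto simp: M_def)
    then obtain as cs where "(as, cs) \<in> dec_pairs n p" "\<alpha> = list_map as cs"
      using Q'_list_mapE by metis
    then show ?thesis
      using list_map_class(3) X by force
  qed (simp add: X zero_class del: One_nat_def)
next
  fix X assume "X \<in> insert (M n (p - 1)) ((\<lambda>(as, cs). {list_map as cs}) ` dec_pairs n p)"
  then have "\<exists>\<alpha>\<in>M n p. X = rees_rel (M n p) (M n (p - 1)) `` {\<alpha>}"
  proof
    assume "X = M n (p - 1)"
    then show ?thesis
      using zero_class[OF empty_in_M] empty_in_M by blast
  qed (use list_map_class in fastforce)
  then show "X \<in> RQ' n p"
    unfolding RQ'_iff .
qed

section \<open>Multiplication in the quotient\<close>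

lemma RQ'_cases:
  assumes "X \<in> RQ' n p"
  obtains "X = M n (p - 1)" | as cs where "(as, cs) \<in> dec_pairs n p" "X = {list_map as cs}"
  using assms unfolding RQ'_eq by auto

lemma RQ'_mult_list_map:
  assumes "(as, bs) \<in> dec_pairs n p" "(bs, cs) \<in> dec_pairs n p"
  shows "RQ'_mult n p {list_map as bs} {list_map bs cs} = {list_map as cs}"
proof -
  have "(as, cs) \<in> dec_pairs n p"
    using dec_pairsD[OF assms(1)] dec_pairsD[OF assms(2)] list_all2_le_trans
    unfolding dec_pairs_def by blast
  moreover have "pmult (list_map as bs) (list_map bs cs) = list_map as cs"
    using dec_pairsD[OF assms(1)] dec_pairsD[OF assms(2)] by (intro pmult_list_map) auto
  ultimately show ?thesis
    using RQ'_mult_class[of "list_map as bs" n p "list_map bs cs"] assms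
    by (simp add: list_map_class del: One_nat_def)
qed

lemma RQ'_mult_list_map_zero:
  assumes "(as, bs) \<in> dec_pairs n p" "(bs', cs) \<in> dec_pairs n p" "bs \<noteq> bs'"
  shows "RQ'_mult n p {list_map as bs} {list_map bs' cs} = M n (p - 1)"
proof -
  have "pmult (list_map as bs) (list_map bs' cs) \<in> M n (p - 1)"
    using height_pmult_less[OF assms] Q'_pmult list_map_in_Q' assms(1,2) by (auto simp: M_def)
  then show ?thesis
    using RQ'_mult_class[of "list_map as bs" n p "list_map bs' cs"] assms(1,2)
    by (simp add: list_map_class zero_class del: One_nat_def)
qed

lemma RQ'_mult_zero:
  assumes "X \<in> RQ' n p"
  shows "RQ'_mult n p X (M n (p - 1)) = M n (p - 1)" "RQ'_mult n p (M n (p - 1)) X = M n (p - 1)"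
proof -
  obtain \<alpha> where \<alpha>: "\<alpha> \<in> M n p" and X: "X = rees_rel (M n p) (M n (p - 1)) `` {\<alpha>}"
    using assms unfolding RQ'_iff by blast
  \<comment> \<open>The empty map represents the zero class, and composing with it on either side
    gives the empty map.\<close>
  have e: "Map.empty \<in> M n p" "Map.empty \<in> M n (p - 1)"
    by (rule empty_in_M)+
  have "pmult \<alpha> Map.empty = Map.empty" "pmult Map.empty \<alpha> = Map.empty"
    by (auto simp: pmult_def map_comp_def split: option.splits)
  then show "RQ'_mult n p X (M n (p - 1)) = M n (p - 1)" "RQ'_mult n p (M n (p - 1)) X = M n (p - 1)"
    using RQ'_mult_class[OF \<alpha> e(1)] RQ'_mult_class[OF e(1) \<alpha>] 
    by (simp_all add: X zero_class[OF e(2)] del: One_nat_def)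
qed

section \<open>Irreducible elements and generation of the quotient\<close>

lemma list_map_in_RQ': "(as, cs) \<in> dec_pairs n p \<Longrightarrow> {list_map as cs} \<in> RQ' n p"
  by (auto simp: RQ'_eq)

lemma list_map_neq_zero: "(as, cs) \<in> dec_pairs n p \<Longrightarrow> {list_map as cs} \<noteq> M n (p - 1)"
  using list_map_class(2) by blast

text \<open>Used twice: it shows that the zero is not irreducible, and that it is generated once all
  nonzero elements are.\<close>

lemma zero_factorization:
  assumes "p < n"
  obtains X where "X \<in> RQ' n p" "X \<noteq> M n (p - 1)" "RQ'_mult n p X X = M n (p - 1)"
proof -
  \<comment> \<open>The shift \<open>x \<mapsto> x - 1\<close> from \<open>{2..p + 1}\<close> onto
    \<open>{1..p}\<close>; it exists because \<open>p < n\<close>, and its square drops in height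
    because image and domain differ.\<close>
  have *: "([2..<p + 2], [1..<p + 1]) \<in> dec_pairs n p"
    using assms by (auto simp: dec_pairs_def inc_lists_def list_all2_conv_all_nth simp del: upt_Suc)
  have "hd [1..<p + 1] \<noteq> hd [2..<p + 2]"
    using p by (simp add: hd_upt del: upt_Suc)
  then have "[1..<p + 1] \<noteq> [2..<p + 2]"
    by metis
  then show ?thesis
    using that list_map_in_RQ'[OF *] list_map_neq_zero[OF *] RQ'_mult_list_map_zero[OF * *] by blast
qed

text \<open>A product is nonzero only if neither factor is zero and the image list of the left
  factor is the domain list of the right one. Factorizations of \<open>{list_map as cs}\<close> thus
  correspond to the intermediate lists in \<open>irr_pairs\<close>, and injectivity of
  \<open>list_map\<close> turns equality with a factor into \<open>bs = as\<close> or
  \<open>bs = cs\<close>.\<close>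

lemma irreducibles_RQ':
  assumes "p < n"
  shows "irreducibles (RQ' n p) (RQ'_mult n p) = (\<lambda>(as, cs). {list_map as cs}) ` irr_pairs n p"
proof (intro equalityI subsetI)
  fix X assume X: "X \<in> irreducibles (RQ' n p) (RQ'_mult n p)"
  then have "X \<in> RQ' n p"
    and irr: "\<And>Y Z. Y \<in> RQ' n p \<Longrightarrow> Z \<in> RQ' n p \<Longrightarrow> X = RQ'_mult n p Y Z \<Longrightarrow> X = Y \<or> X = Z"
    by (auto simp: irreducibles_def)
  from this(1) show "X \<in> (\<lambda>(as, cs). {list_map as cs}) ` irr_pairs n p"
  proof (cases rule: RQ'_cases)
    case 1
    then show ?thesis
      using zero_factorization[OF assms] irr by metis
  next
    case (2 as cs)
    have "bs = as \<or> bs = cs"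
      if bs: "bs \<in> inc_lists 2 n p" "list_all2 (\<le>) cs bs" "list_all2 (\<le>) bs as" for bs
    proof -
      have d: "(as, bs) \<in> dec_pairs n p" "(bs, cs) \<in> dec_pairs n p"
        using bs dec_pairsD[OF 2(1)] inc_lists_mono[of 1 2 n p] by (auto simp: dec_pairs_def)
      have "X = {list_map as bs} \<or> X = {list_map bs cs}"
        using irr[OF list_map_in_RQ'[OF d(1)] list_map_in_RQ'[OF d(2)]]
          RQ'_mult_list_map[OF d] 2(2) by simp
      then show ?thesis
        using list_map_inject[OF 2(1) d(1)] list_map_inject[OF 2(1) d(2)] 2(2) by auto
    qed
    then have "(as, cs) \<in> irr_pairs n p"
      using 2(1) by (auto simp: irr_pairs_def)
    then show ?thesis
      using 2(2) by force
  qed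
next
  fix X assume "X \<in> (\<lambda>(as, cs). {list_map as cs}) ` irr_pairs n p"
  then obtain as cs where X: "X = {list_map as cs}" and d: "(as, cs) \<in> dec_pairs n p"
    and irr: "\<And>bs. bs \<in> inc_lists 2 n p \<Longrightarrow> list_all2 (\<le>) cs bs \<Longrightarrow> list_all2 (\<le>) bs as \<Longrightarrow>
      bs = as \<or> bs = cs"
    by (auto simp: irr_pairs_def)
  have "X = Y \<or> X = Z" if YZ: "Y \<in> RQ' n p" "Z \<in> RQ' n p" "X = RQ'_mult n p Y Z" for Y Z
  proof -
    have "X \<noteq> M n (p - 1)"
      using X list_map_neq_zero[OF d] by simp
    then have "Y \<noteq> M n (p - 1)" "Z \<noteq> M n (p - 1)"
      using YZ RQ'_mult_zero by auto
    then obtain as' bs bs' cs' where Y: "Y = {list_map as' bs}" and Z: "Z = {list_map bs' cs'}"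
      and dY: "(as', bs) \<in> dec_pairs n p" and dZ: "(bs', cs') \<in> dec_pairs n p"
      using RQ'_cases[OF YZ(1)] RQ'_cases[OF YZ(2)] by metis
    have "bs = bs'"
      using RQ'_mult_list_map_zero[OF dY dZ] YZ(3) Y Z \<open>X \<noteq> M n (p - 1)\<close> by auto
    have d': "(as', cs') \<in> dec_pairs n p"
      using dec_pairsD[OF dY] dec_pairsD[OF dZ] list_all2_le_trans \<open>bs = bs'\<close>
      unfolding dec_pairs_def by blast
    have "X = {list_map as' cs'}"
      using RQ'_mult_list_map[of as' bs cs'] dY dZ YZ(3) Y Z \<open>bs = bs'\<close> by simp
    then have "as = as'" "cs = cs'"
      using X list_map_inject[OF d d'] by auto
    then have "bs = as \<or> bs = cs"
      using irr[of bs] dec_pairsD[OF dY] dec_pairsD[OF dZ] \<open>bs = bs'\<close> by blast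
    then show ?thesis
      using X Y Z \<open>as = as'\<close> \<open>cs = cs'\<close> \<open>bs = bs'\<close> by auto
  qed
  then show "X \<in> irreducibles (RQ' n p) (RQ'_mult n p)"
    using X list_map_in_RQ'[OF d] by (auto simp: irreducibles_def)
qed

lemma gen_irreducibles_RQ':
  assumes "p < n"
  shows "gen (RQ'_mult n p) (irreducibles (RQ' n p) (RQ'_mult n p)) = RQ' n p" (is "?G = _")
proof
  show "?G \<subseteq> RQ' n p"
    by (rule gen_subset) (auto simp: irreducibles_def RQ'_mult_closed)
  have nonzero: "{list_map as cs} \<in> ?G" if "(as, cs) \<in> dec_pairs n p" for as cs
    using that
  \<comment> \<open>A reducible pair splits at some \<open>bs\<close> different from both ends. Its
    sum lies strictly between the other two, so both factors have a smaller difference.\<close>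
  proof (induction "sum_list as - sum_list cs" arbitrary: as cs rule: less_induct)
    case less
    show ?case
    proof (cases "(as, cs) \<in> irr_pairs n p")
      case True
      then show ?thesis
        unfolding irreducibles_RQ'[OF assms] by (auto intro!: gen.base)
    next
      case False
      then obtain bs where bs: "bs \<in> inc_lists 2 n p" "list_all2 (\<le>) cs bs" "list_all2 (\<le>) bs as"
        and ne: "cs \<noteq> bs" "bs \<noteq> as"
        using less.prems by (auto simp: irr_pairs_def)
      have d: "(as, bs) \<in> dec_pairs n p" "(bs, cs) \<in> dec_pairs n p"
        using bs dec_pairsD[OF less.prems] inc_lists_mono[of 1 2 n p] by (auto simp: dec_pairs_def)
      have "sum_list cs < sum_list bs" "sum_list bs < sum_list as"
        using bs ne by (auto intro: sum_list_strict_mono_list_all2)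
      then have "{list_map as bs} \<in> ?G" "{list_map bs cs} \<in> ?G"
        using less.hyps d by auto
      then show ?thesis
        using gen.mult RQ'_mult_list_map[OF d] by metis
    qed
  qed
  show "RQ' n p \<subseteq> ?G"
  proof
    fix X assume "X \<in> RQ' n p"
    then show "X \<in> ?G"
    proof (cases rule: RQ'_cases)
      case 1
      \<comment> \<open>The zero is the square of a nonzero element, which is already known to be
        generated.\<close>
      obtain Y where Y: "Y \<in> RQ' n p" "Y \<noteq> M n (p - 1)" "RQ'_mult n p Y Y = M n (p - 1)"
        using zero_factorization[OF assms] .
      then have "Y \<in> ?G"
        using nonzero by (metis RQ'_cases)
      then show ?thesis
        using gen.mult Y(3) 1 by metis
    qed (simp add: nonzero)
  qed
qed

lemma card_irreducibles_RQ':
  assumes "p < n"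
  shows "card (irreducibles (RQ' n p) (RQ'_mult n p)) = card (irr_pairs n p)"
  unfolding irreducibles_RQ'[OF assms]
proof (rule card_image, rule inj_onI)
  fix x y assume xy: "x \<in> irr_pairs n p" "y \<in> irr_pairs n p"
    and eq: "(\<lambda>(as, cs). {list_map as cs}) x = (\<lambda>(as, cs). {list_map as cs}) y"
  have "x \<in> dec_pairs n p" "y \<in> dec_pairs n p"
    using xy by (auto simp: irr_pairs_def)
  then show "x = y"
    using eq list_map_inject[of "fst x" "snd x" n p "fst y" "snd y"]
    by (simp add: case_prod_beta prod_eq_iff)
qed

end

text \<open>For \<open>p = n\<close> no element has height \<open>p\<close>, and the quotient consists of the zero alone.\<close>

lemma srank_RQ'_trivial:
  assumes "1 \<le> n"
  shows "srank (RQ' n n) (RQ'_mult n n) = 1"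
proof -
  let ?Z = "M n (n - 1)"
  have "inc_lists 2 n n = {}"
    using card_inc_lists[of 2 n n] assms finite_inc_lists[of 2 n n] by (simp add: binomial_eq_0)
  then have S: "RQ' n n = {?Z}"
    using RQ'_eq[OF assms] by (simp add: dec_pairs_def)
  \<comment> \<open>In contrast to the case \<open>p < n\<close>, the zero is irreducible here: its
    only factors are itself.\<close>
  then have irr: "irreducibles (RQ' n n) (RQ'_mult n n) = {?Z}"
    by (auto simp: irreducibles_def)
  have "gen (RQ'_mult n n) {?Z} \<subseteq> {?Z}"
    using RQ'_mult_closed[of _ n n] unfolding S by (intro gen_subset subset_refl)
  then have "gen (RQ'_mult n n) {?Z} = {?Z}"
    by (auto intro: gen.base)
  then show ?thesis
    using srank_eq_card_irreducibles[of "RQ' n n" "RQ'_mult n n"] irr S by simp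
qed

theorem theorem3p27:
  fixes n p :: nat
  assumes "2 \<le> p" and "p \<le> n"
  shows "srank (RQ' n p) (RQ'_mult n p) = (n choose p) + (n - 2) * ((n - 3) choose (p - 1))"
proof (cases "p = n")
  \<comment> \<open>The formula gives \<open>1\<close> as well: \<open>n choose n\<close> is
    \<open>1\<close>, and the other binomial vanishes because \<open>n - 3 < n - 1\<close> for
    \<open>2 \<le> n\<close>, also when \<open>n - 3\<close> is truncated to
    \<open>0\<close>.\<close>
  case True
  then show ?thesis
    using assms srank_RQ'_trivial[of n] by (simp add: binomial_eq_0)
next
  case False
  then have "1 \<le> p" "p < n"
    using assms by auto
  then show ?thesis
    using srank_eq_card_irreducibles[OF finite_RQ' gen_irreducibles_RQ']
    by (simp add: card_irreducibles_RQ' card_irr_pairs)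
qed

end
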